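(* Let $U\subset\mathbb{R}^2$ be open and let $\mathbf{I}:U\to\mathcal{M}_{2\times2}(\mathbb{R})$ be a smooth map that decomposes as $$\mathbf{I}=\begin{pmatrix}a_u&b_u\\ a_v&b_v\end{pmatrix}\begin{pmatrix}1+g_1^2&g_1g_2\\ g_1g_2&1+g_2^2\end{pmatrix}\begin{pmatrix}a_u&b_u\\ a_v&b_v\end{pmatrix}^T,$$ in which $g_1,g_2,a,b$ are smooth real functions on $U$ satisfying $(a,b)_u\cdot(g_1,g_2)_v=(a,b)_v\cdot(g_1,g_2)_u$. Then for each $(u_0,v_0)\in U$ and $p\in\mathbb{R}^3$ there is a frontal $\mathbf{x}:V\to\mathbb{R}^3$, with $V\subset U$ a neighborhood of $(u_0,v_0)$, having first fundamental form $\mathbf{I}$ and second fundamental form $D(a,b)^T\,D(g_1,g_2)\,(1+g_1^2+g_2^2)^{-\frac12}$.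
   Context: Smooth means $C^\infty$; subscripts $u,v$ denote partial derivatives; $D\mathbf{f}$ is the Jacobian matrix, e.g. $D(a,b)=\begin{pmatrix}a_u&a_v\\ b_u&b_v\end{pmatrix}$. A smooth map $\mathbf{x}:V\to\mathbb{R}^3$ on an open set $V\subset\mathbb{R}^2$ is a frontal if for every $p\in V$ there are an open neighborhood $V_p\subset V$ of $p$ and a smooth $\nu:V_p\to\mathbb{R}^3$ with $|\nu|=1$ and $\nu\cdot\mathbf{x}_u=\nu\cdot\mathbf{x}_v=0$ on $V_p$. The first fundamental form of $\mathbf{x}$ is the matrix $D\mathbf{x}^TD\mathbf{x}$; the second fundamental form is the matrix $-D\mathbf{x}^TD\nu=\begin{pmatrix}\nu\cdot\mathbf{x}_{uu}&\nu\cdot\mathbf{x}_{uv}\\ \nu\cdot\mathbf{x}_{uv}&\nu\cdot\mathbf{x}_{vv}\end{pmatrix}$ with respect to a chosen smooth unit normal field $\nu:V\to\mathbb{R}^3$ along $\mathbf{x}$ (a smooth unit field orthogonal to $\mathbf{x}_u,\mathbf{x}_v$). *)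

theory Defs
  imports "HOL-Analysis.Analysis"
begin

text \<open>
  Points of the plane are vectors of type \<open>real^2\<close> with coordinates \<open>u = q$1\<close>, \<open>v = q$2\<close>.
  Maps are total; all definitions below look at a map only near the points of an open set.
\<close>

(* k times continuously differentiable; meant for open S.  The derivative of order k + 1 is
   controlled through all directional derivatives of the Frechet derivative. *)
primrec C_on :: "nat \<Rightarrow> 'a::real_normed_vector set \<Rightarrow> ('a \<Rightarrow> 'b::real_normed_vector) \<Rightarrow> bool" where
  "C_on 0 S f \<longleftrightarrow> continuous_on S f"
| "C_on (Suc k) S f \<longleftrightarrow>
     (\<forall>q\<in>S. f differentiable (at q)) \<and>
     (\<forall>h. C_on k S (\<lambda>q. frechet_derivative f (at q) h))"

definition smooth_on :: "'a::real_normed_vector set \<Rightarrow> ('a \<Rightarrow> 'b::real_normed_vector) \<Rightarrow> bool" where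
  "smooth_on S f \<longleftrightarrow> (\<forall>k. C_on k S f)"

definition partial_u :: "(real^2 \<Rightarrow> 'b::real_normed_vector) \<Rightarrow> real^2 \<Rightarrow> 'b" where
  "partial_u f q = vector_derivative (\<lambda>t. f (q + t *\<^sub>R axis 1 1)) (at 0)"

definition partial_v :: "(real^2 \<Rightarrow> 'b::real_normed_vector) \<Rightarrow> real^2 \<Rightarrow> 'b" where
  "partial_v f q = vector_derivative (\<lambda>t. f (q + t *\<^sub>R axis 2 1)) (at 0)"

lemma partial_eq_frechet_derivative:
  assumes "f differentiable (at q)"
  shows "partial_u f q = frechet_derivative f (at q) (axis 1 1)"
    and "partial_v f q = frechet_derivative f (at q) (axis 2 1)"
proof -
  have *: "((\<lambda>t. f (q + t *\<^sub>R h)) has_vector_derivative frechet_derivative f (at q) h) (at 0)" for h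
  proof -
    have f': "(f has_derivative frechet_derivative f (at q)) (at (q + 0 *\<^sub>R h))"
      using assms by (simp add: frechet_derivative_works)
    have "((\<lambda>t. q + t *\<^sub>R h) has_derivative (\<lambda>t. t *\<^sub>R h)) (at (0::real))"
      by (auto intro!: derivative_eq_intros)
    from has_derivative_compose[OF this f']
    show ?thesis
      using assms
      by (simp add: has_vector_derivative_def linear_cmul[OF linear_frechet_derivative])
  qed
  show "partial_u f q = frechet_derivative f (at q) (axis 1 1)"
    and "partial_v f q = frechet_derivative f (at q) (axis 2 1)"
    unfolding partial_u_def partial_v_def by (rule vector_derivative_at[OF *])+
qed

definition pair_map :: "('p \<Rightarrow> real) \<Rightarrow> ('p \<Rightarrow> real) \<Rightarrow> 'p \<Rightarrow> real^2" where
  "pair_map f g = (\<lambda>q. vector [f q, g q])"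

definition mat2 :: "real \<Rightarrow> real \<Rightarrow> real \<Rightarrow> real \<Rightarrow> real^2^2" where
  "mat2 m11 m12 m21 m22 = vector [vector [m11, m12], vector [m21, m22]]"

definition Jac :: "(real^'n::finite \<Rightarrow> real^'m::finite) \<Rightarrow> real^'n \<Rightarrow> real^'n^'m" where
  "Jac f q = jacobian f (at q)"

definition unit_normal_field :: "(real^2) set \<Rightarrow> (real^2 \<Rightarrow> real^3) \<Rightarrow> (real^2 \<Rightarrow> real^3) \<Rightarrow> bool" where
  "unit_normal_field W x \<nu> \<longleftrightarrow>
     smooth_on W \<nu> \<and>
     (\<forall>q\<in>W. norm (\<nu> q) = 1 \<and> \<nu> q \<bullet> partial_u x q = 0 \<and> \<nu> q \<bullet> partial_v x q = 0)"

definition frontal :: "(real^2) set \<Rightarrow> (real^2 \<Rightarrow> real^3) \<Rightarrow> bool" where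
  "frontal V x \<longleftrightarrow>
     open V \<and> smooth_on V x \<and>
     (\<forall>p\<in>V. \<exists>W \<nu>. open W \<and> p \<in> W \<and> W \<subseteq> V \<and> unit_normal_field W x \<nu>)"

definition first_fundamental_form :: "(real^2 \<Rightarrow> real^3) \<Rightarrow> real^2 \<Rightarrow> real^2^2" where
  "first_fundamental_form x q = transpose (Jac x q) ** Jac x q"

definition second_fundamental_form ::
    "(real^2 \<Rightarrow> real^3) \<Rightarrow> (real^2 \<Rightarrow> real^3) \<Rightarrow> real^2 \<Rightarrow> real^2^2" where
  "second_fundamental_form x \<nu> q = - (transpose (Jac x q) ** Jac \<nu> q)"

end

theory Submission
  imports Defs
begin

text \<open>
  The compatibility condition says exactly that the 1-form \<open>\<theta> = g1 da + g2 db\<close> is closed, so near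
  \<open>q0\<close> it has a primitive \<open>c\<close>.  The map \<open>x = (a, b, c)\<close>, translated so that \<open>x q0 = p\<close>, has
  tangent directions orthogonal to \<open>N = (-g1, -g2, 1)\<close>, and \<open>\<nu> = N / |N|\<close> is the required unit normal:
  the term of \<open>d\<nu>\<close> containing \<open>d(1/|N|)\<close> is parallel to \<open>N\<close> and drops out of the second
  fundamental form.
\<close>

section \<open>Closure properties of smooth maps\<close>

text \<open>Openness is the point: agreement on \<open>S\<close> is agreement near each of its
  points, so Frechet derivatives agree on \<open>S\<close> too and the induction can continue. This
  allows derivatives to be replaced by formulas valid only on \<open>S\<close>.\<close>

lemma C_on_cong:
  assumes "open S" "\<And>q. q \<in> S \<Longrightarrow> f q = g q"
  shows "C_on k S f \<longleftrightarrow> C_on k S g"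
proof -
  \<comment> \<open>The hypotheses are symmetric in \<open>f\<close> and \<open>g\<close>, so one
    implication for arbitrary maps gives both directions.\<close>
  have imp: "C_on k S g" if "open S" "\<And>q. q \<in> S \<Longrightarrow> f q = g q" "C_on k S f" for f g :: "'a \<Rightarrow> 'b"
    using that
  proof (induction k arbitrary: f g)
    case 0
    then show ?case by (simp cong: continuous_on_cong)
  next
    case (Suc k)
    have f: "f differentiable (at q)" if "q \<in> S" for q
      using Suc.prems(3) that by simp
    have "(g has_derivative frechet_derivative f (at q)) (at q)" if "q \<in> S" for q
      using f[OF that, unfolded frechet_derivative_works] Suc.prems(1) that Suc.prems(2)
      by (rule has_derivative_transform_within_open)
    then have g: "g differentiable (at q)" "frechet_derivative g (at q) = frechet_derivative f (at q)"
      if "q \<in> S" for q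
      using that frechet_derivative_at unfolding differentiable_def by (blast, metis)
    have "C_on k S (\<lambda>q. frechet_derivative g (at q) h)" for h
      using Suc.IH[of "\<lambda>q. frechet_derivative f (at q) h"] Suc.prems(1,3) g(2) by simp
    with g(1) show ?case by simp
  qed
  show ?thesis
    using imp[of f g] imp[of g f] assms by auto
qed

text \<open>Trades the canonical \<open>frechet_derivative\<close> for any explicit formula
  \<open>f'\<close>, so that the usual differentiation rules can drive inductions on the
  order.\<close>

lemma C_on_SucI:
  assumes "open S" "\<And>q. q \<in> S \<Longrightarrow> (f has_derivative f' q) (at q)"
    and "\<And>h. C_on k S (\<lambda>q. f' q h)"
  shows "C_on (Suc k) S f"
proof -
  have "frechet_derivative f (at q) = f' q" if "q \<in> S" for q
    using frechet_derivative_at[OF assms(2)[OF that]] by simp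
  then have "C_on k S (\<lambda>q. frechet_derivative f (at q) h)" for h
    using assms(3)[of h]
      C_on_cong[OF assms(1), of "\<lambda>q. frechet_derivative f (at q) h" "\<lambda>q. f' q h" k] by simp
  then show ?thesis
    using assms(2) by (auto simp: differentiable_def)
qed

lemma C_on_Suc_has_derivative:
  assumes "C_on (Suc k) S f" "q \<in> S"
  shows "(f has_derivative frechet_derivative f (at q)) (at q)"
  using assms by (simp add: frechet_derivative_works)

lemma C_on_SucD: "C_on (Suc k) S f \<Longrightarrow> C_on k S f"
proof (induction k arbitrary: f)
  case 0
  then show ?case
    by (auto intro!: continuous_at_imp_continuous_on differentiable_imp_continuous_within)
next
  case (Suc k)
  show ?case
    \<comment> \<open>Only one layer is unfolded on each side, which leaves the directional
      derivatives in the shape of the induction hypothesis.\<close>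
    unfolding C_on.simps(2)[of k]
    using Suc.prems Suc.IH by (auto simp: C_on.simps(2)[of "Suc k"] simp del: C_on.simps)
qed

lemma C_on_const: "C_on k S (\<lambda>q. c)"
  by (induction k arbitrary: c) auto

lemma C_on_add:
  assumes "open S" "C_on k S f" "C_on k S g"
  shows "C_on k S (\<lambda>q. f q + g q)"
  using assms
proof (induction k arbitrary: f g)
  case 0
  then show ?case by (auto intro: continuous_on_add)
next
  case (Suc k)
  show ?case
  proof (rule C_on_SucI[OF Suc.prems(1)])
    show "((\<lambda>q. f q + g q) has_derivative
        (\<lambda>h. frechet_derivative f (at q) h + frechet_derivative g (at q) h)) (at q)" if "q \<in> S" for q
      using that Suc.prems by (intro has_derivative_add C_on_Suc_has_derivative)
    show "C_on k S (\<lambda>q. frechet_derivative f (at q) h + frechet_derivative g (at q) h)" for h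
      using Suc by simp
  qed
qed

text \<open>By the product rule the derivative is a sum of two products of one order less; the
  undifferentiated factor is lowered by \<open>C_on_SucD\<close>. Working in the locale covers real
  products and scalar multiples at once.\<close>

lemma (in bounded_bilinear) C_on:
  assumes "open S" "C_on k S f" "C_on k S g"
  shows "C_on k S (\<lambda>q. prod (f q) (g q))"
  using assms
proof (induction k arbitrary: f g)
  case 0
  then show ?case by (auto intro: continuous_on)
next
  case (Suc k)
  show ?case
  proof (rule C_on_SucI[OF Suc.prems(1)])
    show "((\<lambda>q. prod (f q) (g q)) has_derivative
        (\<lambda>h. prod (f q) (frechet_derivative g (at q) h) + prod (frechet_derivative f (at q) h) (g q))) (at q)"
      if "q \<in> S" for q
      using that Suc.prems by (intro FDERIV C_on_Suc_has_derivative)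
    show "C_on k S (\<lambda>q. prod (f q) (frechet_derivative g (at q) h) + prod (frechet_derivative f (at q) h) (g q))" for h
      using Suc.prems C_on_SucD[OF Suc.prems(2)] C_on_SucD[OF Suc.prems(3)]
      by (intro C_on_add Suc.IH) auto
  qed
qed

text \<open>Differentiation lowers the exponent to \<open>r - 1\<close>, so the induction must keep
  \<open>r\<close> arbitrary.\<close>

lemma C_on_powr:
  fixes w :: "'a::real_normed_vector \<Rightarrow> real"
  assumes "open S" "C_on k S w" "\<And>q. q \<in> S \<Longrightarrow> w q > 0"
  shows "C_on k S (\<lambda>q. w q powr r)"
  using assms
proof (induction k arbitrary: r)
  case 0
  then have "w q \<noteq> 0" if "q \<in> S" for q
    using that by force
  with 0 show ?case by (auto intro!: continuous_on_powr)
next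
  case (Suc k)
  show ?case
  proof (rule C_on_SucI[OF Suc.prems(1)])
    show "((\<lambda>q. w q powr r) has_derivative
        (\<lambda>h. (r * w q powr (r - 1)) * frechet_derivative w (at q) h)) (at q)" if "q \<in> S" for q
    proof -
      have "((\<lambda>z. z powr r) has_derivative (*) (r * w q powr (r - 1))) (at (w q))"
        using has_real_derivative_powr[OF Suc.prems(3)[OF that], of r]
        by (simp add: has_field_derivative_def)
      from has_derivative_compose[OF C_on_Suc_has_derivative[OF Suc.prems(2) that] this]
      show ?thesis .
    qed
    show "C_on k S (\<lambda>q. (r * w q powr (r - 1)) * frechet_derivative w (at q) h)" for h
      using Suc.prems Suc.IH[OF Suc.prems(1) C_on_SucD[OF Suc.prems(2)] Suc.prems(3)]
      by (intro bounded_bilinear.C_on[OF bounded_bilinear_mult] C_on_const) auto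
  qed
qed

section \<open>Passage from finite order to smoothness\<close>

lemma smooth_on_const: "smooth_on S (\<lambda>q. c)"
  by (simp add: smooth_on_def C_on_const)

lemma smooth_on_add: "open S \<Longrightarrow> smooth_on S f \<Longrightarrow> smooth_on S g \<Longrightarrow> smooth_on S (\<lambda>q. f q + g q)"
  by (simp add: smooth_on_def C_on_add)

lemma (in bounded_bilinear) smooth_on:
  "open S \<Longrightarrow> smooth_on S f \<Longrightarrow> smooth_on S g \<Longrightarrow> smooth_on S (\<lambda>q. prod (f q) (g q))"
  by (simp add: smooth_on_def C_on)

lemmas smooth_on_mult = bounded_bilinear.smooth_on[OF bounded_bilinear_mult]
lemmas smooth_on_scaleR = bounded_bilinear.smooth_on[OF bounded_bilinear_scaleR]

lemma smooth_on_powr: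
  fixes w :: "'a::real_normed_vector \<Rightarrow> real"
  shows "open S \<Longrightarrow> smooth_on S w \<Longrightarrow> (\<And>q. q \<in> S \<Longrightarrow> w q > 0) \<Longrightarrow> smooth_on S (\<lambda>q. w q powr r)"
  by (simp add: smooth_on_def C_on_powr)

text \<open>Each order \<open>k\<close> follows from order \<open>Suc k\<close>, which avoids
  treating continuity separately. It will upgrade a primitive, known only to be differentiable, to a
  smooth function.\<close>

lemma smooth_onI:
  assumes "open S" "\<And>q. q \<in> S \<Longrightarrow> (f has_derivative f' q) (at q)"
    and "\<And>h. smooth_on S (\<lambda>q. f' q h)"
  shows "smooth_on S f"
  unfolding smooth_on_def
proof
  show "C_on k S f" for k
    using assms(3) by (blast intro: C_on_SucD[OF C_on_SucI[OF assms(1,2)]] dest: smooth_on_def[THEN iffD1])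
qed

lemma smooth_on_frechet_derivative: "smooth_on S f \<Longrightarrow> smooth_on S (\<lambda>q. frechet_derivative f (at q) h)"
  unfolding smooth_on_def
proof
  show "C_on k S (\<lambda>q. frechet_derivative f (at q) h)" if "\<forall>k. C_on k S f" for k
    using that[rule_format, of "Suc k"] by simp
qed

lemma smooth_on_has_derivative:
  "smooth_on S f \<Longrightarrow> q \<in> S \<Longrightarrow> (f has_derivative frechet_derivative f (at q)) (at q)"
  unfolding smooth_on_def by (rule C_on_Suc_has_derivative[of 0]) (rule spec)

lemma smooth_on_differentiable: "smooth_on S f \<Longrightarrow> q \<in> S \<Longrightarrow> f differentiable (at q)"
  using smooth_on_has_derivative differentiable_def by blast

lemma smooth_on_imp_continuous_on: "smooth_on S f \<Longrightarrow> continuous_on S f"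
  unfolding smooth_on_def C_on.simps(1)[symmetric] by blast

lemma smooth_on_subset:
  assumes "smooth_on S f" "T \<subseteq> S"
  shows "smooth_on T f"
proof -
  have "C_on k T f" if "C_on k S f" for k
    using that \<open>T \<subseteq> S\<close>
    by (induction k arbitrary: f) (auto intro: continuous_on_subset)
  with assms(1) show ?thesis by (simp add: smooth_on_def)
qed

section \<open>Symmetry of second derivatives\<close>

text \<open>Chain rule along an affine path. The free set \<open>T\<close> serves integrals over
  closed intervals as well as one-sided derivatives.\<close>

lemma has_vector_derivative_along_line:
  fixes f :: "'a::real_normed_vector \<Rightarrow> 'b::real_normed_vector"
  assumes "(f has_derivative f') (at (q + t *\<^sub>R h))"
  shows "((\<lambda>t. f (q + t *\<^sub>R h)) has_vector_derivative f' h) (at t within T)"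
proof -
  have "((\<lambda>t. q + t *\<^sub>R h) has_derivative (\<lambda>t. t *\<^sub>R h)) (at t within T)"
    by (auto intro!: derivative_eq_intros)
  from has_derivative_compose[OF this assms]
  show ?thesis
    by (simp add: has_vector_derivative_def linear_cmul[OF has_derivative_linear[OF assms]])
qed

text \<open>
  The increment of \<open>f\<close> in direction \<open>k\<close> is an integral of the derivative along \<open>k\<close>;
  differentiating it along \<open>h\<close> under the integral sign and then along \<open>k\<close> gives the claim.
\<close>

lemma frechet_derivative_commute:
  fixes f :: "'a::real_normed_vector \<Rightarrow> 'b::banach"
  assumes S: "open S" "q \<in> S" and f: "smooth_on S f"
  shows "frechet_derivative (\<lambda>q. frechet_derivative f (at q) h) (at q) k =
         frechet_derivative (\<lambda>q. frechet_derivative f (at q) k) (at q) h"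
proof -
  let ?D = "\<lambda>f q h. frechet_derivative f (at q) h"
  have lin: "isCont (\<lambda>z. q + fst z *\<^sub>R h + snd z *\<^sub>R k) (0::real, 0::real)"
    by (intro continuous_intros)
  \<comment> \<open>Pulling the open set \<open>S\<close> back along the affine parametrization
    gives a disc of radius \<open>e\<close> in the parameter plane.\<close>
  have "\<forall>\<^sub>F z in at (0::real,0::real). q + fst z *\<^sub>R h + snd z *\<^sub>R k \<in> S"
    using lin S by (auto simp: isCont_def intro: topological_tendstoD)
  then obtain e where e: "e > 0" "\<And>z. z \<noteq> (0,0) \<Longrightarrow> dist z (0,0) < e \<Longrightarrow> q + fst z *\<^sub>R h + snd z *\<^sub>R k \<in> S"
    unfolding eventually_at by auto
  \<comment> \<open>With this choice \<open>\<bar>s\<bar> + \<bar>t\<bar>\<close> is at most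
    \<open>2 * e / 3 < e\<close>, so a whole square of parameters stays in the disc.\<close>
  define d where "d = e / 3"
  have "d > 0" using e(1) by (simp add: d_def)
  have inS: "q + s *\<^sub>R h + t *\<^sub>R k \<in> S" if "s \<in> {-d..d}" "t \<in> {-d..d}" for s t
  proof (cases "(s, t) = (0, 0)")
    case False
    have "dist (s,t) (0,0) \<le> \<bar>s\<bar> + \<bar>t\<bar>"
      by (simp add: dist_Pair_Pair sqrt_sum_squares_le_sum_abs)
    also have "\<dots> < e"
      using that e(1) by (auto simp: d_def abs_le_iff)
    finally show ?thesis using e(2)[of "(s,t)"] False by simp
  qed (use S in auto)
  have f1: "(f has_derivative ?D f x) (at x)" if "x \<in> S" for x
    using smooth_on_has_derivative[OF f that] .
  have f2: "((\<lambda>q. ?D f q j) has_derivative ?D (\<lambda>q. ?D f q j) x) (at x)" if "x \<in> S" for x j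
    using smooth_on_has_derivative[OF smooth_on_frechet_derivative[OF f] that] .
  have cont: "continuous_on T (\<lambda>z. ?D f (q + s z *\<^sub>R h + t z *\<^sub>R k) j)"
    "continuous_on T (\<lambda>z. ?D (\<lambda>q. ?D f q j) (q + s z *\<^sub>R h + t z *\<^sub>R k) i)"
    if "continuous_on T s" "continuous_on T t" "s ` T \<subseteq> {-d..d}" "t ` T \<subseteq> {-d..d}"
    for T :: "'z::topological_space set" and s t j i
    using that inS
    by (intro continuous_on_compose2[OF smooth_on_imp_continuous_on[OF smooth_on_frechet_derivative[OF f]]]
        continuous_on_compose2[OF smooth_on_imp_continuous_on[OF
          smooth_on_frechet_derivative[OF smooth_on_frechet_derivative[OF f]]]] continuous_intros;
        force simp: image_subset_iff)+
  have incr: "f (q + s *\<^sub>R h + t *\<^sub>R k) - f (q + s *\<^sub>R h)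
      = integral {0..t} (\<lambda>\<tau>. ?D f (q + s *\<^sub>R h + \<tau> *\<^sub>R k) k)"
    if "s \<in> {-d..d}" "t \<in> {0..d}" for s t
  proof -
    have "((\<lambda>\<tau>. ?D f (q + s *\<^sub>R h + \<tau> *\<^sub>R k) k) has_integral
        f (q + s *\<^sub>R h + t *\<^sub>R k) - f (q + s *\<^sub>R h + 0 *\<^sub>R k)) {0..t}"
      using that
      by (intro fundamental_theorem_of_calculus has_vector_derivative_along_line f1 inS) auto
    then show ?thesis by (simp add: integral_unique)
  qed
  \<comment> \<open>Both sides are the derivative at \<open>s = 0\<close> of the increment
    \<open>incr\<close>: the right one by differentiating under the integral, the left one by
    differentiating \<open>f\<close> itself.\<close>
  have eq: "?D f (q + t *\<^sub>R k) h - ?D f q h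
      = integral {0..t} (\<lambda>\<tau>. ?D (\<lambda>q. ?D f q k) (q + \<tau> *\<^sub>R k) h)"
    if t: "t \<in> {0..d}" for t
  proof -
    \<comment> \<open>Zero is an interior point, so the derivative within the interval is an
      ordinary one and hence unique.\<close>
    have within: "at (0::real) within {-d..d} = at 0"
      using \<open>d > 0\<close> by (intro at_within_interior) auto
    have "((\<lambda>s. integral (cbox 0 t) (\<lambda>\<tau>. ?D f (q + s *\<^sub>R h + \<tau> *\<^sub>R k) k)) has_vector_derivative
        integral (cbox 0 t) (\<lambda>\<tau>. ?D (\<lambda>q. ?D f q k) (q + 0 *\<^sub>R h + \<tau> *\<^sub>R k) h)) (at 0 within {-d..d})"
    proof (rule leibniz_rule_vector_derivative)
      fix s \<tau> assume st: "s \<in> {-d..d}" "\<tau> \<in> cbox 0 t"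
      then have "q + \<tau> *\<^sub>R k + s *\<^sub>R h \<in> S"
        using inS[of s \<tau>] t by (simp add: add_ac)
      from has_vector_derivative_along_line[OF f2[OF this]]
      show "((\<lambda>s. ?D f (q + s *\<^sub>R h + \<tau> *\<^sub>R k) k) has_vector_derivative
          ?D (\<lambda>q. ?D f q k) (q + s *\<^sub>R h + \<tau> *\<^sub>R k) h) (at s within {-d..d})"
        by (simp add: add_ac)
    next
      fix s assume "s \<in> {-d..d}"
      then show "(\<lambda>\<tau>. ?D f (q + s *\<^sub>R h + \<tau> *\<^sub>R k) k) integrable_on cbox 0 t"
        using t by (intro integrable_continuous cont continuous_intros) auto
    next
      show "continuous_on ({-d..d} \<times> cbox 0 t)
          (\<lambda>(s, \<tau>). ?D (\<lambda>q. ?D f q k) (q + s *\<^sub>R h + \<tau> *\<^sub>R k) h)"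
        unfolding case_prod_beta
        using t by (intro cont continuous_intros) auto
    qed (use \<open>d > 0\<close> in auto)
    moreover have "((\<lambda>s. integral (cbox 0 t) (\<lambda>\<tau>. ?D f (q + s *\<^sub>R h + \<tau> *\<^sub>R k) k)) has_vector_derivative
        ?D f (q + t *\<^sub>R k) h - ?D f q h) (at 0 within {-d..d})"
    proof (rule has_vector_derivative_transform)
      have 1: "q + t *\<^sub>R k + 0 *\<^sub>R h \<in> S"
        using inS[of 0 t] \<open>d > 0\<close> t by simp
      have 2: "q + 0 *\<^sub>R h \<in> S"
        using S by simp
      from has_vector_derivative_diff[OF has_vector_derivative_along_line[OF f1[OF 1]]
          has_vector_derivative_along_line[OF f1[OF 2]]]
      show "((\<lambda>s. f (q + s *\<^sub>R h + t *\<^sub>R k) - f (q + s *\<^sub>R h)) has_vector_derivative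
          ?D f (q + t *\<^sub>R k) h - ?D f q h) (at 0 within {-d..d})"
        by (simp add: add_ac)
    qed (use \<open>d > 0\<close> incr t in auto)
    ultimately show ?thesis
      unfolding within by (auto dest: vector_derivative_unique_at)
  qed
  \<comment> \<open>The increment formula holds for \<open>t\<close> in \<open>{0..d}\<close>, so
    the outer derivative is taken from the right; it is still unique because
    \<open>d > 0\<close>.\<close>
  have "((\<lambda>t. ?D f (q + t *\<^sub>R k) h) has_vector_derivative ?D (\<lambda>q. ?D f q k) q h) (at 0 within {0..d})"
  proof -
    have "((\<lambda>t. integral {0..t} (\<lambda>\<tau>. ?D (\<lambda>q. ?D f q k) (q + \<tau> *\<^sub>R k) h)) has_vector_derivative
        ?D (\<lambda>q. ?D f q k) (q + 0 *\<^sub>R k) h) (at 0 within {0..d})"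
      using cont(2)[of "{0..d}" "\<lambda>_. 0" "\<lambda>t. t" k h] \<open>d > 0\<close>
        integral_has_vector_derivative[of 0 d "\<lambda>\<tau>. ?D (\<lambda>q. ?D f q k) (q + \<tau> *\<^sub>R k) h" 0]
      by (simp add: image_subset_iff)
    then have "((\<lambda>t. ?D f q h + integral {0..t} (\<lambda>\<tau>. ?D (\<lambda>q. ?D f q k) (q + \<tau> *\<^sub>R k) h)) has_vector_derivative
        ?D (\<lambda>q. ?D f q k) q h) (at 0 within {0..d})"
      by (auto intro!: derivative_eq_intros)
    then show ?thesis
      by (rule has_vector_derivative_transform[rotated 2]) (use \<open>d > 0\<close> in \<open>auto simp: eq[symmetric]\<close>)
  qed
  moreover have "((\<lambda>t. ?D f (q + t *\<^sub>R k) h) has_vector_derivative ?D (\<lambda>q. ?D f q h) q k) (at 0 within {0..d})"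
    using has_vector_derivative_along_line[of "\<lambda>q. ?D f q h" _ q 0 k] f2[OF S(2)] by simp
  ultimately show ?thesis
    using vector_derivative_unique_within_closed_interval[of 0 d 0] \<open>d > 0\<close> by auto
qed

section \<open>Poincare lemma\<close>

text \<open>
  The primitive is the integral of \<open>\<omega>\<close> along the segment from \<open>q0\<close>.  By closedness the derivative
  of its integrand in direction \<open>h\<close> is the \<open>t\<close>-derivative of \<open>t *\<^sub>R \<omega> (q0 + t *\<^sub>R (x - q0)) \<bullet> h\<close>.
\<close>

lemma poincare_lemma:
  fixes \<omega> :: "'a::euclidean_space \<Rightarrow> 'a"
  assumes B: "open B" "convex B" "q0 \<in> B" and \<omega>: "smooth_on B \<omega>"
    and closed: "\<And>q h k. q \<in> B \<Longrightarrow>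
      frechet_derivative \<omega> (at q) h \<bullet> k = frechet_derivative \<omega> (at q) k \<bullet> h"
  obtains c where "\<And>q. q \<in> B \<Longrightarrow> (c has_derivative (\<lambda>h. \<omega> q \<bullet> h)) (at q)"
proof
  let ?D = "\<lambda>q h. frechet_derivative \<omega> (at q) h"
  define y where "y = (\<lambda>x t. q0 + t *\<^sub>R (x - q0))"
  \<comment> \<open>\<open>F x t\<close> plays two roles: closedness makes it the gradient in
    \<open>x\<close> of the integrand, and it is the \<open>t\<close>-derivative of
    \<open>t *\<^sub>R \<omega> (y x t)\<close>.\<close>
  define F where "F = (\<lambda>x t. \<omega> (y x t) + t *\<^sub>R ?D (y x t) (x - q0))"
  have yB: "y x t \<in> B" if "x \<in> B" "t \<in> {0..1}" for x t
    using convexD_alt[OF B(2) B(3) that(1), of t] that(2) by (simp add: y_def algebra_simps)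
  have d: "(\<omega> has_derivative ?D q) (at q)" if "q \<in> B" for q
    using smooth_on_has_derivative[OF \<omega> that] .
  have conty: "continuous_on T (\<lambda>z. y (f z) (g z))" if "continuous_on T f" "continuous_on T g"
    for T :: "'z::topological_space set" and f g
    unfolding y_def using that by (intro continuous_intros)
  have cont: "continuous_on (B \<times> {0..1}) (\<lambda>(x, t). F x t)"
  proof -
    \<comment> \<open>Smoothness gives continuity of the derivative only in fixed directions, so the
      moving direction \<open>x - q0\<close> is expanded in the basis.\<close>
    have *: "?D (y x t) (x - q0) = (\<Sum>b\<in>Basis. ((x - q0) \<bullet> b) *\<^sub>R ?D (y x t) b)"
      if "x \<in> B" "t \<in> {0..1}" for x t
    proof -
      have lin: "linear (?D (y x t))"
        using d[OF yB[OF that]] by (rule has_derivative_linear)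
      show ?thesis
        by (subst euclidean_representation[of "x - q0", symmetric])
          (simp only: linear_sum[OF lin] linear_cmul[OF lin])
    qed
    have "continuous_on (B \<times> {0..1}) (\<lambda>z. \<omega> (y (fst z) (snd z)) +
        snd z *\<^sub>R (\<Sum>b\<in>Basis. ((fst z - q0) \<bullet> b) *\<^sub>R ?D (y (fst z) (snd z)) b))"
      by (intro continuous_intros conty
          continuous_on_compose2[OF smooth_on_imp_continuous_on[OF \<omega>]]
          continuous_on_compose2[OF smooth_on_imp_continuous_on[OF smooth_on_frechet_derivative[OF \<omega>]]])
        (auto intro: yB)
    then show ?thesis
      by (rule continuous_on_cong[THEN iffD1, rotated 2]) (auto simp: F_def *)
  qed
  fix q assume q: "q \<in> B"
  \<comment> \<open>The Leibniz rule expects derivatives as bounded linear operators;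
    \<open>blinfun_inner_right\<close> turns the gradient into one.\<close>
  have "((\<lambda>x. integral (cbox 0 1) (\<lambda>t. \<omega> (y x t) \<bullet> (x - q0))) has_derivative
      integral (cbox 0 1) (\<lambda>t. blinfun_inner_right (F q t))) (at q within B)"
  proof (rule leibniz_rule)
    fix x and t :: real assume xt: "x \<in> B" "t \<in> cbox 0 1"
    have yb: "y x t \<in> B" using yB xt by simp
    have "((\<lambda>x. y x t) has_derivative (\<lambda>h. t *\<^sub>R h)) (at x within B)"
      unfolding y_def by (auto intro!: derivative_eq_intros)
    from has_derivative_compose[OF this d[OF yb]]
    have "((\<lambda>x. \<omega> (y x t)) has_derivative (\<lambda>h. t *\<^sub>R ?D (y x t) h)) (at x within B)"
      by (simp add: linear_cmul[OF has_derivative_linear[OF d[OF yb]]])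
    moreover have "((\<lambda>x. x - q0) has_derivative (\<lambda>h. h)) (at x within B)"
      by (auto intro!: derivative_eq_intros)
    ultimately have "((\<lambda>x. \<omega> (y x t) \<bullet> (x - q0)) has_derivative
        (\<lambda>h. \<omega> (y x t) \<bullet> h + t *\<^sub>R ?D (y x t) h \<bullet> (x - q0))) (at x within B)"
      by (rule has_derivative_inner)
    \<comment> \<open>Closedness swaps \<open>h\<close> with \<open>x - q0\<close>, making the
      expression an inner product with \<open>h\<close>.\<close>
    moreover have "\<omega> (y x t) \<bullet> h + t *\<^sub>R ?D (y x t) h \<bullet> (x - q0) = F x t \<bullet> h" for h
      using closed[OF yb, of h "x - q0"] by (simp add: F_def inner_add_left)
    ultimately show "((\<lambda>x. \<omega> (y x t) \<bullet> (x - q0)) has_derivative blinfun_apply (blinfun_inner_right (F x t)))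
        (at x within B)"
      by simp
  next
    fix x assume "x \<in> B"
    then show "(\<lambda>t. \<omega> (y x t) \<bullet> (x - q0)) integrable_on cbox 0 1"
      by (intro integrable_continuous continuous_intros conty
          continuous_on_compose2[OF smooth_on_imp_continuous_on[OF \<omega>]]) (auto intro: yB)
  next
    show "continuous_on (B \<times> cbox 0 1) (\<lambda>(x, t). blinfun_inner_right (F x t))"
      using bounded_linear.continuous_on[OF bounded_linear_blinfun_inner_right cont]
      by (simp add: case_prod_beta)
  qed (use B q in auto)
  moreover have "integral (cbox 0 1) (\<lambda>t. blinfun_inner_right (F q t)) = blinfun_inner_right (\<omega> q)"
  proof -
    \<comment> \<open>The factor \<open>t\<close> kills the lower endpoint, and the upper one is
      \<open>\<omega> q\<close> because \<open>y q 1 = q\<close>.\<close>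
    have "(F q has_integral 1 *\<^sub>R \<omega> (y q 1) - 0 *\<^sub>R \<omega> (y q 0)) {0..1}"
    proof (intro fundamental_theorem_of_calculus)
      fix t :: real assume t: "t \<in> {0..1}"
      have "((\<lambda>t. \<omega> (y q t)) has_vector_derivative ?D (y q t) (q - q0)) (at t within {0..1})"
        using d[OF yB[OF q t]] unfolding y_def by (rule has_vector_derivative_along_line)
      from has_vector_derivative_scaleR[OF DERIV_ident this]
      show "((\<lambda>t. t *\<^sub>R \<omega> (y q t)) has_vector_derivative F q t) (at t within {0..1})"
        by (simp add: F_def add.commute)
    qed simp
    from has_integral_linear[OF this bounded_linear_blinfun_inner_right]
    have "((\<lambda>t. blinfun_inner_right (F q t)) has_integral blinfun_inner_right (\<omega> (y q 1))) (cbox 0 1)"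
      by (simp add: o_def)
    then have "integral (cbox 0 1) (\<lambda>t. blinfun_inner_right (F q t)) = blinfun_inner_right (\<omega> (y q 1))"
      by (rule integral_unique)
    then show ?thesis by (simp add: y_def)
  qed
  ultimately show "((\<lambda>x. integral (cbox 0 1) (\<lambda>t. \<omega> (y x t) \<bullet> (x - q0))) has_derivative (\<lambda>h. \<omega> q \<bullet> h)) (at q)"
    by (simp add: at_within_open[OF q B(1)])
qed

section \<open>Frontals with a prescribed decomposition\<close>

lemma Jac_nth: "Jac f q $ i $ j = frechet_derivative f (at q) (axis j 1) $ i"
  by (simp add: Jac_def jacobian_def matrix_def)

text \<open>Reduces both fundamental forms, and the product of Jacobians in the claim, to inner
  products of directional derivatives.\<close>

lemma transpose_Jac_mult_nth:
  "(transpose (Jac f q) ** Jac g q) $ i $ j =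
    frechet_derivative f (at q) (axis i 1) \<bullet> frechet_derivative g (at q) (axis j 1)"
  by (simp add: matrix_matrix_mult_def transpose_def Jac_nth inner_vec_def)

lemma axis2_expand: "h = h $ 1 *\<^sub>R axis 1 1 + h $ 2 *\<^sub>R axis 2 (1::real)" for h :: "real^2"
  by (simp add: vec_eq_iff forall_2 axis_def)

lemma pair_map_eq: "pair_map f g = (\<lambda>q. f q *\<^sub>R axis 1 1 + g q *\<^sub>R axis 2 1)"
  by (simp add: pair_map_def fun_eq_iff vec_eq_iff forall_2 axis_def)

lemma frechet_derivative_pair_map:
  assumes "(f has_derivative f') (at q)" "(g has_derivative g') (at q)"
  shows "(pair_map f g has_derivative (\<lambda>h. vector [f' h, g' h])) (at q)"
    and "frechet_derivative (pair_map f g) (at q) h = vector [f' h, g' h]"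
proof -
  have "(pair_map f g has_derivative (\<lambda>h. f' h *\<^sub>R axis 1 1 + g' h *\<^sub>R axis 2 1)) (at q)"
    unfolding pair_map_eq using assms by (auto intro!: derivative_eq_intros)
  moreover have "f' h *\<^sub>R axis 1 1 + g' h *\<^sub>R axis 2 1 = (vector [f' h, g' h] :: real^2)" for h
    by (simp add: vec_eq_iff forall_2 axis_def)
  ultimately show *: "(pair_map f g has_derivative (\<lambda>h. vector [f' h, g' h])) (at q)"
    by simp
  show "frechet_derivative (pair_map f g) (at q) h = vector [f' h, g' h]"
    using frechet_derivative_at[OF *] by metis
qed

theorem theorem3p10:
  fixes U :: "(real^2) set"
    and I :: "real^2 \<Rightarrow> real^2^2"
    and a b g1 g2 :: "real^2 \<Rightarrow> real"
    and q0 :: "real^2"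
    and p :: "real^3"
  assumes "open U"
    and "smooth_on U I"
    and "smooth_on U a" and "smooth_on U b"
    and "smooth_on U g1" and "smooth_on U g2"
    and "\<And>q. q \<in> U \<Longrightarrow>
           I q = mat2 (partial_u a q) (partial_u b q)
                      (partial_v a q) (partial_v b q)
              ** mat2 (1 + (g1 q)\<^sup>2) (g1 q * g2 q)
                      (g1 q * g2 q) (1 + (g2 q)\<^sup>2)
              ** transpose (mat2 (partial_u a q) (partial_u b q)
                                 (partial_v a q) (partial_v b q))"
    and "\<And>q. q \<in> U \<Longrightarrow>
           partial_u (pair_map a b) q \<bullet> partial_v (pair_map g1 g2) q
         = partial_v (pair_map a b) q \<bullet> partial_u (pair_map g1 g2) q"
    and "q0 \<in> U"
  shows "\<exists>V x \<nu>. q0 \<in> V \<and> V \<subseteq> U \<and> frontal V x \<and> x q0 = p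
           \<and> unit_normal_field V x \<nu>
           \<and> (\<forall>q\<in>V. first_fundamental_form x q = I q)
           \<and> (\<forall>q\<in>V. second_fundamental_form x \<nu> q
                 = ((1 + (g1 q)\<^sup>2 + (g2 q)\<^sup>2) powr (- (1/2))) *\<^sub>R
                     (transpose (Jac (pair_map a b) q) ** Jac (pair_map g1 g2) q))"
proof -
  let ?D = "\<lambda>f q h. frechet_derivative f (at q) h"
  have sU: "smooth_on U a" "smooth_on U b" "smooth_on U g1" "smooth_on U g2"
    and I: "\<And>q. q \<in> U \<Longrightarrow>
           I q = mat2 (partial_u a q) (partial_u b q)
                      (partial_v a q) (partial_v b q)
              ** mat2 (1 + (g1 q)\<^sup>2) (g1 q * g2 q)
                      (g1 q * g2 q) (1 + (g2 q)\<^sup>2)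
              ** transpose (mat2 (partial_u a q) (partial_u b q)
                                 (partial_v a q) (partial_v b q))"
    and compat: "\<And>q. q \<in> U \<Longrightarrow>
           partial_u (pair_map a b) q \<bullet> partial_v (pair_map g1 g2) q
         = partial_v (pair_map a b) q \<bullet> partial_u (pair_map g1 g2) q"
    using assms by blast+
  \<comment> \<open>A ball supplies the convexity needed for the Poincare lemma.\<close>
  obtain r where "r > 0" and r: "ball q0 r \<subseteq> U"
    using \<open>open U\<close> \<open>q0 \<in> U\<close> openE by blast
  define V where "V = ball q0 r"
  have V: "open V" "convex V" "q0 \<in> V" "V \<subseteq> U"
    using \<open>r > 0\<close> r by (auto simp: V_def)
  have s: "smooth_on V a" "smooth_on V b" "smooth_on V g1" "smooth_on V g2"
    using sU smooth_on_subset V(4) by blast+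
  note sD = smooth_on_frechet_derivative
  have d: "(a has_derivative ?D a q) (at q)" "(b has_derivative ?D b q) (at q)"
    "(g1 has_derivative ?D g1 q) (at q)" "(g2 has_derivative ?D g2 q) (at q)"
    "((\<lambda>q. ?D a q k) has_derivative ?D (\<lambda>q. ?D a q k) q) (at q)"
    "((\<lambda>q. ?D b q k) has_derivative ?D (\<lambda>q. ?D b q k) q) (at q)" if "q \<in> V" for q k
    using s that by (auto intro!: smooth_on_has_derivative sD)
  have part: "partial_u f q = ?D f q (axis 1 1)" "partial_v f q = ?D f q (axis 2 1)"
    if "smooth_on V f" "q \<in> V" for f :: "real^2 \<Rightarrow> real" and q
    using partial_eq_frechet_derivative[OF smooth_on_differentiable[OF that]] .

  \<comment> \<open>The closed 1-form and its primitive\<close>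
  define \<theta> where "\<theta> = (\<lambda>q h. g1 q * ?D a q h + g2 q * ?D b q h)"
  \<comment> \<open>The vector field representing the form \<open>\<theta>\<close> through the inner
    product, as the Poincare lemma requires.\<close>
  define \<omega> :: "real^2 \<Rightarrow> real^2" where "\<omega> = (\<lambda>q. \<theta> q (axis 1 1) *\<^sub>R axis 1 1 + \<theta> q (axis 2 1) *\<^sub>R axis 2 1)"
  have \<theta>: "smooth_on V (\<lambda>q. \<theta> q h)" for h
    unfolding \<theta>_def using s V(1) by (intro smooth_on_add smooth_on_mult sD)
  have \<omega>: "smooth_on V \<omega>"
    unfolding \<omega>_def by (intro smooth_on_add smooth_on_scaleR smooth_on_const \<theta> V)
  have split: "f' h = h $ 1 * f' (axis 1 1) + h $ 2 * f' (axis 2 1)"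
    if "(f has_derivative f') (at q)" for f f' :: "real^2 \<Rightarrow> real" and q h
    by (subst axis2_expand[of h])
      (simp only: linear_add[OF has_derivative_linear[OF that]]
        linear_cmul[OF has_derivative_linear[OF that]] real_scaleR_def)
  have \<omega>_inner: "\<omega> q \<bullet> h = \<theta> q h" if "q \<in> V" for q h
    using split[OF d(1)[OF that], of h] split[OF d(2)[OF that], of h]
    by (simp add: \<omega>_def \<theta>_def inner_add_left inner_axis' algebra_simps)
  have D\<omega>: "?D \<omega> q h \<bullet> k = ?D g1 q h * ?D a q k + g1 q * ?D (\<lambda>q. ?D a q k) q h
      + (?D g2 q h * ?D b q k + g2 q * ?D (\<lambda>q. ?D b q k) q h)" if q: "q \<in> V" for q h k
  proof -
    have "((\<lambda>q. \<omega> q \<bullet> k) has_derivative (\<lambda>h. ?D \<omega> q h \<bullet> k)) (at q)"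
      by (intro has_derivative_inner_left smooth_on_has_derivative[OF \<omega> q])
    then have "((\<lambda>q. \<theta> q k) has_derivative (\<lambda>h. ?D \<omega> q h \<bullet> k)) (at q)"
      using V(1) q \<omega>_inner by (rule has_derivative_transform_within_open)
    moreover have "((\<lambda>q. \<theta> q k) has_derivative
        (\<lambda>h. (g1 q * ?D (\<lambda>q. ?D a q k) q h + ?D g1 q h * ?D a q k)
          + (g2 q * ?D (\<lambda>q. ?D b q k) q h + ?D g2 q h * ?D b q k))) (at q)"
      unfolding \<theta>_def by (intro has_derivative_add has_derivative_mult d q)
    ultimately have "(\<lambda>h. ?D \<omega> q h \<bullet> k) =
        (\<lambda>h. (g1 q * ?D (\<lambda>q. ?D a q k) q h + ?D g1 q h * ?D a q k)
          + (g2 q * ?D (\<lambda>q. ?D b q k) q h + ?D g2 q h * ?D b q k))"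
      by (rule has_derivative_unique)
    from fun_cong[OF this, of h] show ?thesis by simp
  qed
  have closed: "?D \<omega> q h \<bullet> k = ?D \<omega> q k \<bullet> h" if q: "q \<in> V" for q h k
  proof -
    note dp = frechet_derivative_pair_map[OF d(1,2)[OF q]]
    note dg = frechet_derivative_pair_map[OF d(3,4)[OF q]]
    have diff: "pair_map a b differentiable (at q)" "pair_map g1 g2 differentiable (at q)"
      using dp(1) dg(1) by (auto simp: differentiable_def)
    have "?D a q (axis 1 1) * ?D g1 q (axis 2 1) + ?D b q (axis 1 1) * ?D g2 q (axis 2 1)
        = ?D a q (axis 2 1) * ?D g1 q (axis 1 1) + ?D b q (axis 2 1) * ?D g2 q (axis 1 1)"
      using compat[of q] q V(4)
      by (auto simp: partial_eq_frechet_derivative[OF diff(1)] partial_eq_frechet_derivative[OF diff(2)]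
          dp(2) dg(2) inner_vec_def sum_2)
    \<comment> \<open>The difference of the two sides is bilinear and alternating in
      \<open>h\<close> and \<open>k\<close>, hence a multiple of its value on the coordinate
      directions, which vanishes by compatibility.\<close>
    then have "?D g1 q h * ?D a q k + ?D g2 q h * ?D b q k = ?D g1 q k * ?D a q h + ?D g2 q k * ?D b q h"
      unfolding split[OF d(1)[OF q], of h] split[OF d(2)[OF q], of h]
        split[OF d(3)[OF q], of h] split[OF d(4)[OF q], of h]
        split[OF d(1)[OF q], of k] split[OF d(2)[OF q], of k]
        split[OF d(3)[OF q], of k] split[OF d(4)[OF q], of k]
      by algebra
    \<comment> \<open>The remaining terms carry second derivatives of \<open>a\<close> and
      \<open>b\<close> and match by symmetry.\<close>
    then show ?thesis
      unfolding D\<omega>[OF q] frechet_derivative_commute[OF V(1) q s(1), of k h]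
        frechet_derivative_commute[OF V(1) q s(2), of k h] by simp
  qed
  obtain c where "\<And>q. q \<in> V \<Longrightarrow> (c has_derivative (\<lambda>h. \<omega> q \<bullet> h)) (at q)"
    using poincare_lemma[OF V(1-3) \<omega> closed] by blast
  then have dc: "(c has_derivative \<theta> q) (at q)" if "q \<in> V" for q
    using that \<omega>_inner[OF that] by (metis ext)
  have sc: "smooth_on V c"
    using V(1) dc \<theta> by (rule smooth_onI)

  \<comment> \<open>The frontal, its unit normal and its fundamental forms\<close>
  define X :: "real^2 \<Rightarrow> real^3" where
    "X = (\<lambda>q. a q *\<^sub>R axis 1 1 + b q *\<^sub>R axis 2 1 + c q *\<^sub>R axis 3 1)"
  define x where "x = (\<lambda>q. X q + (p - X q0))"
  define w where "w = (\<lambda>q. 1 + (g1 q)\<^sup>2 + (g2 q)\<^sup>2)"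
  \<comment> \<open>Negation is written as multiplication by \<open>- 1\<close> so that the closure
    rules for sums, products and constants suffice.\<close>
  define N :: "real^2 \<Rightarrow> real^3" where
    "N = (\<lambda>q. axis 3 1 + ((- 1 * g1 q) *\<^sub>R axis 1 1 + (- 1 * g2 q) *\<^sub>R axis 2 1))"
  define \<sigma> where "\<sigma> = (\<lambda>q. w q powr (- (1/2)))"
  define \<nu> where "\<nu> = (\<lambda>q. \<sigma> q *\<^sub>R N q)"
  have w: "w q > 0" for q
    unfolding w_def by (smt (verit) zero_le_power2)
  have sx: "smooth_on V x"
    unfolding x_def X_def by (intro smooth_on_add smooth_on_scaleR smooth_on_const s sc V)
  have s\<sigma>: "smooth_on V \<sigma>"
    unfolding \<sigma>_def using w unfolding w_def power2_eq_square
    by (intro smooth_on_powr smooth_on_add smooth_on_mult smooth_on_const s V)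
  have sN: "smooth_on V N"
    unfolding N_def by (intro smooth_on_add smooth_on_scaleR smooth_on_mult smooth_on_const s V)
  have s\<nu>: "smooth_on V \<nu>"
    unfolding \<nu>_def by (intro smooth_on_scaleR s\<sigma> sN V)
  have Dx: "?D x q h = ?D a q h *\<^sub>R axis 1 1 + ?D b q h *\<^sub>R axis 2 1 + \<theta> q h *\<^sub>R axis 3 1"
    if "q \<in> V" for q h
  proof -
    have "(x has_derivative
        (\<lambda>h. ?D a q h *\<^sub>R axis 1 1 + ?D b q h *\<^sub>R axis 2 1 + \<theta> q h *\<^sub>R axis 3 1)) (at q)"
      unfolding x_def X_def using d(1,2)[OF that] dc[OF that] by (auto intro!: derivative_eq_intros)
    from fun_cong[OF frechet_derivative_at[OF this]] show ?thesis by simp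
  qed
  \<comment> \<open>The derivative of \<open>\<sigma>\<close> needs no explicit formula, since its
    term is a multiple of \<open>N q\<close>.\<close>
  have D\<nu>: "?D \<nu> q h = \<sigma> q *\<^sub>R ((- ?D g1 q h) *\<^sub>R axis 1 1 + (- ?D g2 q h) *\<^sub>R axis 2 1) + ?D \<sigma> q h *\<^sub>R N q"
    if "q \<in> V" for q h
  proof -
    have "(N has_derivative (\<lambda>h. (- ?D g1 q h) *\<^sub>R axis 1 1 + (- ?D g2 q h) *\<^sub>R axis 2 1)) (at q)"
      unfolding N_def using d(3,4)[OF that] by (auto intro!: derivative_eq_intros)
    from has_derivative_scaleR[OF smooth_on_has_derivative[OF s\<sigma> that] this]
    have "(\<nu> has_derivative (\<lambda>h. \<sigma> q *\<^sub>R ((- ?D g1 q h) *\<^sub>R axis 1 1 + (- ?D g2 q h) *\<^sub>R axis 2 1)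
        + ?D \<sigma> q h *\<^sub>R N q)) (at q)"
      unfolding \<nu>_def .
    from fun_cong[OF frechet_derivative_at[OF this]] show ?thesis by simp
  qed
  \<comment> \<open>The third component of the derivative of \<open>x\<close> is
    \<open>g1 da + g2 db\<close>, which cancels the first two components paired with
    \<open>N\<close>.\<close>
  have ortho: "N q \<bullet> ?D x q h = 0" "?D x q h \<bullet> N q = 0" if "q \<in> V" for q h
    by (simp_all add: Dx[OF that] N_def \<theta>_def inner_vec_def sum_3 axis_def)
  have norm\<nu>: "norm (\<nu> q) = 1" for q
  proof -
    have "norm (N q) = sqrt (w q)"
      by (simp add: norm_eq_sqrt_inner N_def w_def inner_vec_def sum_3 axis_def power2_eq_square)
    moreover have "\<sigma> q = 1 / sqrt (w q)"
      using w[of q] by (simp add: \<sigma>_def powr_minus_divide powr_half_sqrt)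
    ultimately show ?thesis
      using w[of q] by (simp add: \<nu>_def)
  qed
  have normal: "unit_normal_field V x \<nu>"
    unfolding unit_normal_field_def
    using s\<nu> norm\<nu> ortho partial_eq_frechet_derivative[OF smooth_on_differentiable[OF sx]]
    by (simp add: \<nu>_def)
  moreover have "frontal V x"
    unfolding frontal_def using V(1) sx normal by blast
  moreover have "x q0 = p"
    by (simp add: x_def)
  moreover have "first_fundamental_form x q = I q" if q: "q \<in> V" for q
  proof -
    \<comment> \<open>Expanding the product of the two \<open>\<theta>\<close> factors produces the
      entries with \<open>g1\<close> and \<open>g2\<close> of the middle matrix.\<close>
    have "?D x q h \<bullet> ?D x q k = ?D a q h * ?D a q k + ?D b q h * ?D b q k + \<theta> q h * \<theta> q k" for h k
      by (simp add: Dx[OF q] inner_vec_def sum_3 axis_def)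
    then have "first_fundamental_form x q $ i $ j =
        ?D a q (axis i 1) * ?D a q (axis j 1) + ?D b q (axis i 1) * ?D b q (axis j 1)
          + \<theta> q (axis i 1) * \<theta> q (axis j 1)" for i j
      by (simp add: first_fundamental_form_def transpose_Jac_mult_nth)
    moreover have "I q = mat2 (?D a q (axis 1 1)) (?D b q (axis 1 1)) (?D a q (axis 2 1)) (?D b q (axis 2 1))
        ** mat2 (1 + (g1 q)\<^sup>2) (g1 q * g2 q) (g1 q * g2 q) (1 + (g2 q)\<^sup>2)
        ** transpose (mat2 (?D a q (axis 1 1)) (?D b q (axis 1 1)) (?D a q (axis 2 1)) (?D b q (axis 2 1)))"
      using I[of q] q V(4) part[OF s(1) q] part[OF s(2) q] by auto
    ultimately show ?thesis
      by (simp add: vec_eq_iff forall_2 matrix_matrix_mult_def mat2_def sum_2 transpose_def \<theta>_def power2_eq_square algebra_simps)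
  qed
  moreover have "second_fundamental_form x \<nu> q
      = ((1 + (g1 q)\<^sup>2 + (g2 q)\<^sup>2) powr (- (1/2))) *\<^sub>R
          (transpose (Jac (pair_map a b) q) ** Jac (pair_map g1 g2) q)" if q: "q \<in> V" for q
  proof -
    \<comment> \<open>Orthogonality removes the \<open>N q\<close> term; the minus sign left over
      cancels the one in \<open>second_fundamental_form\<close>.\<close>
    have "?D x q h \<bullet> ?D \<nu> q k = - (\<sigma> q * (?D a q h * ?D g1 q k + ?D b q h * ?D g2 q k))" for h k
      unfolding D\<nu>[OF q] inner_add_right inner_scaleR_right[of _ _ "N q"] ortho[OF q]
      by (simp add: Dx[OF q] inner_vec_def sum_3 axis_def algebra_simps)
    then have "second_fundamental_form x \<nu> q = \<sigma> q *\<^sub>R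
        (transpose (Jac (pair_map a b) q) ** Jac (pair_map g1 g2) q)"
      \<comment> \<open>Inner products are expanded only for vectors built by \<open>vector\<close>,
        so those of \<open>x\<close> and \<open>\<nu>\<close> still match the preceding
        identity.\<close>
      by (simp add: vec_eq_iff second_fundamental_form_def transpose_Jac_mult_nth
          frechet_derivative_pair_map(2)[OF d(1,2)[OF q]]
          frechet_derivative_pair_map(2)[OF d(3,4)[OF q]] inner_vec_def[of "vector _"] sum_2)
    then show ?thesis by (simp add: \<sigma>_def w_def)
  qed
  ultimately show ?thesis
    using V by blast
qed

end
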